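(* For every dimension $d$ there exists a $c_d>0$ such that for every $\alpha\in(1-c_d,1]$ there exists a $\beta>0$ such that the following holds. Let $P$ be a monotone property of boxes, and let $\mathcal{B}$ be a finite family of boxes in $\mathbb{R}^d$. If at least $\alpha\binom{|\mathcal{B}|}{2}$ of the pairs in $\mathcal{B}$ are $P$-intersecting, then there exists a $P$-intersecting subfamily $\mathcal{B}'\subseteq\mathcal{B}$ of size at least $\beta|\mathcal{B}|$.
   Context: A box in $\mathbb{R}^d$ is an axis-parallel box, i.e. a set of the form $[a_1,b_1]\times\cdots\times[a_d,b_d]$ (an intersection of $2d$ closed coordinate halfspaces, one for each direction $\pm e_i$); degenerate boxes and the empty set are allowed, so that an intersection of boxes is a box. A property $P$ of boxes (a class of boxes) is monotone if $B\in P$ and $B\subseteq C$ imply $C\in P$ for all boxes $B,C$. A family of boxes is $P$-intersecting if the intersection of its members has property $P$.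
   Formalization: The family is assumed to have at least two boxes; for a single box the claim fails as written (take P to be the property that no box has, so 0 ≥ 0 pairs are P-intersecting but no subfamily is), and for the empty family the intersection is not a box. *)

theory Defs
  imports "HOL-Analysis.Analysis"
begin

text \<open>
  \<^term>\<open>cbox a b\<close> is the product of the intervals \<open>[a $ i, b $ i]\<close>; it is degenerate or
  empty when \<open>a $ i = b $ i\<close> or \<open>a $ i > b $ i\<close> for some \<open>i\<close>.
\<close>

definition boxes :: "(real ^ 'n) set set" where
  "boxes = {cbox a b | a b. True}"

definition monotone_box_property :: "(real ^ 'n) set set \<Rightarrow> bool" where
  "monotone_box_property P \<longleftrightarrow>
     P \<subseteq> boxes \<and> (\<forall>B\<in>boxes. \<forall>C\<in>boxes. B \<in> P \<longrightarrow> B \<subseteq> C \<longrightarrow> C \<in> P)"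

text \<open>
  Families are indexed, so repeated members are allowed. The intersection of the empty family
  is the whole space, which is not a box, so the empty family is never \<open>P\<close>-intersecting for a
  class \<open>P\<close> of boxes.
\<close>

definition P_intersecting ::
    "(real ^ 'n) set set \<Rightarrow> ('i \<Rightarrow> (real ^ 'n) set) \<Rightarrow> 'i set \<Rightarrow> bool" where
  "P_intersecting P B J \<longleftrightarrow> (\<Inter>j\<in>J. B j) \<in> P"

definition P_intersecting_pairs ::
    "(real ^ 'n) set set \<Rightarrow> ('i \<Rightarrow> (real ^ 'n) set) \<Rightarrow> 'i set \<Rightarrow> 'i set set" where
  "P_intersecting_pairs P B I = {K. K \<subseteq> I \<and> card K = 2 \<and> P_intersecting P B K}"

end

theory Submission
  imports Defs
begin

text \<open>
  A pair \<open>x, z\<close> of members is useful if \<open>B x \<inter> B z\<close> lies in linearly many members \<open>B y\<close>: if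
  \<open>B x \<inter> B z\<close> has the monotone property \<open>P\<close>, so does the intersection of all these \<open>B y\<close>.
  It therefore suffices that a positive fraction of all pairs, depending only on the dimension,
  is useful: if at most a fraction \<open>1 - \<alpha>\<close> of the pairs fails to be \<open>P\<close>-intersecting and
  \<open>1 - \<alpha>\<close> is smaller than the fraction of useful pairs, some pair is both useful and
  \<open>P\<close>-intersecting (\<open>dense_pairs_meet_dense_relation\<close>).

  To find useful pairs, colour each ordered pair \<open>(x, y)\<close> by the comparisons of the \<open>2d\<close> endpoint
  coordinates of \<open>B x\<close> with those of \<open>B y\<close>. If \<open>(x, y)\<close> and \<open>(y, z)\<close> have the same colour, then
  every endpoint coordinate of \<open>B y\<close> lies between those of \<open>B x\<close> and \<open>B z\<close>, whence
  \<open>B x \<inter> B z \<subseteq> B y\<close> (\<open>same_endpoint_order_imp_Int_subset\<close>). With boundedly many colours, a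
  positive fraction of all triples is of this kind (\<open>many_equicoloured_triples\<close>), and averaging over
  the outer pair \<open>(x, z)\<close> turns this into many pairs that have many middle points \<open>y\<close>
  (\<open>many_heavy_pairs\<close>). Equal outer members \<open>x = z\<close> are negligible for large families; in a family
  of bounded size a single \<open>P\<close>-intersecting pair is large enough.
\<close>

section \<open>Equicoloured triples\<close>

text \<open>
  This is a quantitative form of the fact that the shift graph has large chromatic number. Let
  \<open>T x\<close> be the set of colours that are popular among the pairs starting at \<open>x\<close>. By pigeonhole,
  many \<open>x\<close> share the same \<open>T x\<close>. For most pairs \<open>x, y\<close> of such points the colour of \<open>(x, y)\<close> is
  popular at \<open>x\<close>, hence popular at \<open>y\<close>, so that many \<open>z\<close> continue it in the same colour.
\<close>

lemma many_equicoloured_triples: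
  fixes col :: "'a \<Rightarrow> 'a \<Rightarrow> 'c::finite" and I :: "'a set"
  assumes fin: "finite I"
  defines "C \<equiv> real CARD('c)" and "M \<equiv> 2 ^ CARD('c)"
  shows "real (card I) ^ 3 / (4 * C * M ^ 3)
           \<le> real (card (SIGMA p:I \<times> I. {y \<in> I. col (fst p) y = col y (snd p)}))"
proof (cases "I = {}")
  case False
  define n where "n = real (card I)"
  define \<delta> where "\<delta> = 1 / (2 * C * M)"
  have n: "n > 0" using fin False by (simp add: n_def card_gt_0_iff)
  have C: "C > 0" by (simp add: C_def)
  have M: "M > 0" by (simp add: M_def)
  define out where "out x c = {y \<in> I. col x y = c}" for x c
  define T where "T x = {c. real (card (out x c)) \<ge> \<delta> * n}" for x
  have finout: "finite (out x c)" for x c using fin by (simp add: out_def)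
  obtain U where U: "n / M \<le> real (card {x \<in> I. T x = U})"
  proof (rule ccontr)
    assume *: "\<not> thesis"
    have "I = (\<Union>U\<in>(UNIV :: 'c set set). {x \<in> I. T x = U})" by auto
    then have "card I \<le> (\<Sum>U\<in>(UNIV :: 'c set set). card {x \<in> I. T x = U})"
      using card_UN_le[OF finite_class.finite_UNIV, of "\<lambda>U. {x \<in> I. T x = U}"] by simp
    then have "n \<le> (\<Sum>U\<in>(UNIV :: 'c set set). real (card {x \<in> I. T x = U}))"
      unfolding n_def by (metis of_nat_le_iff of_nat_sum)
    also have "\<dots> < (\<Sum>U\<in>(UNIV :: 'c set set). n / M)"
      using * that by (intro sum_strict_mono) (auto simp: not_le[symmetric])
    also have "\<dots> = n" using M by (simp add: M_def card_Pow flip: Pow_UNIV)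
    finally show False by simp
  qed
  define S where "S = {x \<in> I. T x = U}"
  have S: "n / M \<le> real (card S)" "S \<subseteq> I" using U by (auto simp: S_def)
  have finS: "finite S" using S fin finite_subset by blast
  define Y where "Y x = {y \<in> S. col x y \<in> T x}" for x
  have finY: "finite (Y x)" for x using finS by (simp add: Y_def)
  have Y: "real (card (Y x)) \<ge> n / (2 * M)" for x
  proof -
    have "S \<subseteq> Y x \<union> (\<Union>c\<in>- T x. out x c)" using S by (auto simp: Y_def out_def)
    then have "card S \<le> card (Y x \<union> (\<Union>c\<in>- T x. out x c))"
      using finY finout by (intro card_mono) auto
    also have "\<dots> \<le> card (Y x) + (\<Sum>c\<in>- T x. card (out x c))"
      by (intro order_trans[OF card_Un_le] add_left_mono card_UN_le) simp
    finally have "real (card S) \<le> real (card (Y x)) + (\<Sum>c\<in>- T x. real (card (out x c)))"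
      by (metis of_nat_le_iff of_nat_sum of_nat_add)
    also have "(\<Sum>c\<in>- T x. real (card (out x c))) \<le> (\<Sum>c\<in>- T x. \<delta> * n)"
      by (intro sum_mono) (auto simp: T_def)
    also have "\<dots> \<le> C * (\<delta> * n)"
    proof -
      have "real (card (- T x)) \<le> C" by (simp add: C_def card_mono)
      moreover have "0 \<le> \<delta> * n" using C M n by (simp add: \<delta>_def)
      ultimately show ?thesis by (simp add: mult_right_mono)
    qed
    also have "\<dots> = n / (2 * M)" using C M by (simp add: \<delta>_def)
    finally have "n / M \<le> real (card (Y x)) + n / (2 * M)" using S by linarith
    then show ?thesis using M by (simp add: field_simps)
  qed
  define W where "W = (SIGMA x:S. SIGMA y:Y x. out y (col x y))"
  have "n ^ 3 / (4 * C * M ^ 3) = (n / M) * ((n / (2 * M)) * (\<delta> * n))"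
    using C M by (simp add: \<delta>_def field_simps power3_eq_cube)
  also have "\<dots> \<le> real (card S) * ((n / (2 * M)) * (\<delta> * n))"
    using S n M C by (intro mult_right_mono) (auto simp: \<delta>_def)
  also have "\<dots> = (\<Sum>x\<in>S. (n / (2 * M)) * (\<delta> * n))" by simp
  also have "\<dots> \<le> (\<Sum>x\<in>S. \<Sum>y\<in>Y x. real (card (out y (col x y))))"
  proof (rule sum_mono)
    fix x assume x: "x \<in> S"
    have "(n / (2 * M)) * (\<delta> * n) \<le> real (card (Y x)) * (\<delta> * n)"
      using Y n M C by (intro mult_right_mono) (auto simp: \<delta>_def)
    also have "\<dots> = (\<Sum>y\<in>Y x. \<delta> * n)" by simp
    also have "\<dots> \<le> (\<Sum>y\<in>Y x. real (card (out y (col x y))))"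
    proof (rule sum_mono)
      fix y assume "y \<in> Y x"
      then have "col x y \<in> T y" using x by (auto simp: Y_def S_def)
      then show "\<delta> * n \<le> real (card (out y (col x y)))" by (simp add: T_def)
    qed
    finally show "(n / (2 * M)) * (\<delta> * n) \<le> (\<Sum>y\<in>Y x. real (card (out y (col x y))))" .
  qed
  also have "\<dots> = real (card W)"
    using finS finY finout by (simp add: W_def card_SigmaI)
  also have "card W \<le> card (SIGMA p:I \<times> I. {y \<in> I. col (fst p) y = col y (snd p)})"
  proof (rule card_inj_on_le[where f = "\<lambda>(x, y, z). ((x, z), y)"])
    show "inj_on (\<lambda>(x, y, z). ((x, z), y)) W" by (auto simp: inj_on_def)
    show "(\<lambda>(x, y, z). ((x, z), y)) ` W
            \<subseteq> (SIGMA p:I \<times> I. {y \<in> I. col (fst p) y = col y (snd p)})"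
      using S by (auto simp: W_def Y_def out_def)
    show "finite (SIGMA p:I \<times> I. {y \<in> I. col (fst p) y = col y (snd p)})"
      using fin by (intro finite_SigmaI) auto
  qed
  finally show ?thesis by (simp add: n_def)
qed simp

text \<open>
  Averaging: the pairs with fewer than \<open>\<gamma> n / 2\<close> middle points account for at most \<open>\<gamma> n\<^sup>3 / 2\<close>
  triples, and every other pair for at most \<open>n\<close>.
\<close>

lemma many_heavy_pairs:
  fixes I :: "'a set" and F :: "'a \<times> 'a \<Rightarrow> 'a set"
  assumes fin: "finite I" and F: "\<And>p. F p \<subseteq> I" and "\<gamma> \<ge> 0"
    and dense: "\<gamma> * real (card I) ^ 3 \<le> real (card (SIGMA p:I \<times> I. F p))"
  shows "\<gamma> / 2 * real (card I) ^ 2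
           \<le> real (card {p \<in> I \<times> I. \<gamma> / 2 * real (card I) \<le> real (card (F p))})"
proof (cases "I = {}")
  case False
  define n where "n = real (card I)"
  have n: "n > 0" using fin False by (simp add: n_def card_gt_0_iff)
  define G where "G = {p \<in> I \<times> I. \<gamma> / 2 * n \<le> real (card (F p))}"
  have G: "finite G" "G \<subseteq> I \<times> I" using fin by (auto simp: G_def)
  have finF: "finite (F p)" for p using F fin finite_subset by blast
  have "\<gamma> * n ^ 3 \<le> (\<Sum>p\<in>I \<times> I. real (card (F p)))"
    using dense fin finF by (simp add: n_def card_SigmaI)
  also have "\<dots> \<le> (\<Sum>p\<in>I \<times> I. (if p \<in> G then n else 0) + \<gamma> / 2 * n)"
  proof (rule sum_mono)
    fix p assume "p \<in> I \<times> I"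
    moreover have "real (card (F p)) \<le> n" using F fin by (simp add: n_def card_mono)
    ultimately show "real (card (F p)) \<le> (if p \<in> G then n else 0) + \<gamma> / 2 * n"
      using n \<open>\<gamma> \<ge> 0\<close> by (auto simp: G_def intro: add_increasing2)
  qed
  also have "\<dots> = (\<Sum>p\<in>I \<times> I. if p \<in> G then n else 0) + n * n * (\<gamma> / 2 * n)"
    by (simp add: sum.distrib card_cartesian_product n_def)
  also have "(\<Sum>p\<in>I \<times> I. if p \<in> G then n else 0) = real (card G) * n"
    using G fin by (simp add: Int_absorb1 flip: sum.inter_restrict)
  finally have "(\<gamma> / 2 * n ^ 2) * n \<le> real (card G) * n"
    by (simp add: power2_eq_square power3_eq_cube mult_ac)
  then show ?thesis using n by (simp add: G_def n_def)
qed simp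

section \<open>Boxes\<close>

text \<open>
  Equality of the sets of coordinates says that each endpoint coordinate passes monotonically
  through its values at \<open>x\<close>, \<open>y\<close>, \<open>z\<close>. So each lower endpoint at \<open>y\<close> is at most the larger of
  the other two, and each upper endpoint at \<open>y\<close> is at least the smaller.
\<close>

lemma same_endpoint_order_imp_Int_subset:
  fixes a b :: "'i \<Rightarrow> real ^ 'n"
  assumes "{k. a x $ k \<le> a y $ k} = {k. a y $ k \<le> a z $ k}"
    and "{k. b x $ k \<le> b y $ k} = {k. b y $ k \<le> b z $ k}"
  shows "cbox (a x) (b x) \<inter> cbox (a z) (b z) \<subseteq> cbox (a y) (b y)"
proof
  fix v assume "v \<in> cbox (a x) (b x) \<inter> cbox (a z) (b z)"
  then have v: "a x $ k \<le> v $ k" "v $ k \<le> b x $ k" "a z $ k \<le> v $ k" "v $ k \<le> b z $ k" for k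
    by (auto simp: mem_box_cart)
  have "a y $ k \<le> v $ k \<and> v $ k \<le> b y $ k" for k
  proof -
    have "(a x $ k \<le> a y $ k) = (a y $ k \<le> a z $ k)" "(b x $ k \<le> b y $ k) = (b y $ k \<le> b z $ k)"
      using assms by (simp_all add: set_eq_iff)
    then show ?thesis using v[of k] by linarith
  qed
  then show "v \<in> cbox (a y) (b y)" by (simp add: mem_box_cart)
qed

lemma INT_boxes:
  assumes "finite J" "J \<noteq> {}" "\<And>j. j \<in> J \<Longrightarrow> B j \<in> boxes"
  shows "(\<Inter>j\<in>J. B j) \<in> boxes"
  using assms
proof (induction rule: finite_ne_induct)
  case (singleton j)
  then show ?case by simp
next
  case (insert j J)
  then have "B j \<in> boxes" "(\<Inter>j\<in>J. B j) \<in> boxes" by auto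
  then obtain a b c d where "B j = cbox a b" "(\<Inter>j\<in>J. B j) = cbox c d"
    unfolding boxes_def by blast
  then show ?case unfolding INT_insert boxes_def by (auto simp only: Int_interval)
qed

lemma P_intersecting_of_superboxes:
  assumes P: "monotone_box_property P"
    and J: "finite J" "J \<noteq> {}" "\<And>j. j \<in> J \<Longrightarrow> B j \<in> boxes"
    and A: "A \<in> P" "\<And>j. j \<in> J \<Longrightarrow> A \<subseteq> B j"
  shows "P_intersecting P B J"
proof -
  have "A \<in> boxes" using P A by (auto simp: monotone_box_property_def)
  moreover have "A \<subseteq> (\<Inter>j\<in>J. B j)" using A by auto
  moreover have "(\<Inter>j\<in>J. B j) \<in> boxes" using J by (rule INT_boxes)
  ultimately show ?thesis
    using P \<open>A \<in> P\<close> unfolding monotone_box_property_def P_intersecting_def by metis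
qed

section \<open>Finding a useful pair that is \<open>P\<close>-intersecting\<close>

lemma card_ordered_pairs:
  fixes Q :: "'a set set"
  assumes "finite Q" "\<And>K. K \<in> Q \<Longrightarrow> card K = 2"
  shows "card {(x, z). {x, z} \<in> Q} = 2 * card Q"
proof -
  define R where "R K = {(x, z). {x, z} = K}" for K :: "'a set"
  have R: "card (R K) = 2 \<and> finite (R K)" if K: "K \<in> Q" for K
  proof -
    obtain x y where "K = {x, y}" "x \<noteq> y" using assms(2)[OF K] by (auto simp: card_2_iff)
    then have "R K = {(x, y), (y, x)}" by (auto simp: R_def doubleton_eq_iff)
    with \<open>x \<noteq> y\<close> show ?thesis by simp
  qed
  have "{(x, z). {x, z} \<in> Q} = (\<Union>K\<in>Q. R K)" by (auto simp: R_def)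
  also have "card \<dots> = (\<Sum>K\<in>Q. card (R K))"
    using assms R by (intro card_UN_disjoint) (auto simp: R_def)
  also have "\<dots> = 2 * card Q" using R by simp
  finally show ?thesis .
qed

text \<open>
  If no pair of \<open>G\<close> were in \<open>Q\<close>, the ordered pairs from \<open>Q\<close> and those in \<open>G\<close> would be too many
  to fit disjointly into \<open>I \<times> I\<close>. The summand \<open>card I\<close> makes up for the diagonal, which \<open>G\<close>
  may contain: an equicoloured triple may have equal outer members.
\<close>

lemma dense_pairs_meet_dense_relation:
  fixes I :: "'a set" and Q :: "'a set set"
  assumes fin: "finite I" and G: "G \<subseteq> I \<times> I" and Q: "\<And>K. K \<in> Q \<Longrightarrow> K \<subseteq> I \<and> card K = 2"
    and dense: "real (card Q) \<ge> \<alpha> * real (card I choose 2)" and "\<alpha> \<le> 1"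
    and large: "real (card G) > (1 - \<alpha>) * real (card I) ^ 2 + real (card I)"
  shows "\<exists>(x, z)\<in>G. {x, z} \<in> Q"
proof (rule ccontr)
  assume none: "\<not> ?thesis"
  define n where "n = real (card I)"
  define R where "R = {(x, z). {x, z} \<in> Q}"
  have "Q \<subseteq> Pow I" using Q by auto
  then have finQ: "finite Q" using fin by (meson finite_Pow_iff finite_subset)
  have cardR: "card R = 2 * card Q" unfolding R_def using finQ Q by (intro card_ordered_pairs) auto
  have RI: "R \<subseteq> I \<times> I" using Q by (auto simp: R_def)
  have "R \<inter> G = {}" using none by (auto simp: R_def)
  then have "card R + card G = card (R \<union> G)"
    using G RI fin by (metis card_Un_disjoint finite_SigmaI finite_subset)
  also have "\<dots> \<le> card (I \<times> I)" using G RI fin by (intro card_mono) auto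
  finally have "2 * card Q + card G \<le> card I * card I"
    by (simp add: cardR card_cartesian_product)
  then have "real (2 * card Q + card G) \<le> real (card I * card I)" by (rule of_nat_mono)
  then have "2 * real (card Q) + real (card G) \<le> n ^ 2" by (simp add: n_def power2_eq_square)
  moreover have pairs: "2 * real (card I choose 2) = n * (n - 1)"
    using choose_two[of "card I"] by (cases "card I") (auto simp: n_def real_of_nat_div algebra_simps)
  moreover have "\<alpha> * n \<le> n" using mult_right_mono[OF \<open>\<alpha> \<le> 1\<close>, of n] by (simp add: n_def)
  moreover have "2 * real (card Q) \<ge> \<alpha> * (n * (n - 1))" using dense by (simp flip: pairs)
  moreover have "real (card G) > n ^ 2 - \<alpha> * n ^ 2 + n" using large by (simp add: n_def algebra_simps)
  ultimately show False by (simp add: power2_eq_square algebra_simps)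
qed

theorem theorem1p7:
  shows "\<exists>c>0. \<forall>\<alpha>::real. 1 - c < \<alpha> \<and> \<alpha> \<le> 1 \<longrightarrow>
    (\<exists>\<beta>>0. \<forall>(P :: (real ^ 'n) set set) (I :: nat set) (B :: nat \<Rightarrow> (real ^ 'n) set).
      monotone_box_property P \<longrightarrow>
      finite I \<longrightarrow> card I \<ge> 2 \<longrightarrow> (\<forall>i\<in>I. B i \<in> boxes) \<longrightarrow>
      real (card (P_intersecting_pairs P B I)) \<ge> \<alpha> * real (card I choose 2) \<longrightarrow>
      (\<exists>J\<subseteq>I. P_intersecting P B J \<and> real (card J) \<ge> \<beta> * real (card I)))"
proof -
  \<comment> \<open>The colours are pairs of sets of coordinates; \<open>\<gamma>\<close> is the resulting density of triples.\<close>
  define \<gamma> where "\<gamma> = 1 / (4 * real CARD('n set \<times> 'n set) * (2 ^ CARD('n set \<times> 'n set)) ^ 3)"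
  have \<gamma>: "0 < \<gamma>" "\<gamma> \<le> 1"
  proof -
    have "1 \<le> real CARD('n set \<times> 'n set)"
      by (metis One_nat_def Suc_leI of_nat_1 of_nat_mono zero_less_card_finite)
    moreover have "(1::real) \<le> (2 ^ CARD('n set \<times> 'n set)) ^ 3" by simp
    ultimately have "1 * 1 \<le> (4 * real CARD('n set \<times> 'n set)) * (2 ^ CARD('n set \<times> 'n set)) ^ 3"
      by (intro mult_mono) auto
    then show "0 < \<gamma>" "\<gamma> \<le> 1" unfolding \<gamma>_def by (auto simp: divide_simps)
  qed
  have main: "\<exists>J\<subseteq>I. P_intersecting P B J \<and> real (card J) \<ge> \<gamma> / 2 * real (card I)"
    if \<alpha>: "1 - \<gamma> / 4 < \<alpha>" "\<alpha> \<le> 1" and P: "monotone_box_property P"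
      and I: "finite I" "card I \<ge> 2" and boxes: "\<forall>i\<in>I. B i \<in> boxes"
      and dense: "real (card (P_intersecting_pairs P B I)) \<ge> \<alpha> * real (card I choose 2)"
    for \<alpha> and P :: "(real ^ 'n) set set" and I :: "nat set" and B
  proof (cases "\<gamma> / 4 * real (card I) \<le> 1")
    case True
    \<comment> \<open>A single pair already has size \<open>2 \<ge> \<gamma> / 2 * card I\<close>.\<close>
    have "0 < card I choose 2" using I by (simp add: zero_less_binomial)
    then have "0 < \<alpha> * real (card I choose 2)" using \<alpha> \<gamma> by simp
    then have "P_intersecting_pairs P B I \<noteq> {}" using dense by auto
    then obtain K where "K \<subseteq> I" "card K = 2" "P_intersecting P B K"
      by (auto simp: P_intersecting_pairs_def)
    with True show ?thesis by (intro exI[of _ K]) auto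
  next
    \<comment> \<open>Now the \<open>\<gamma> / 2 * n\<^sup>2\<close> heavy pairs outnumber the \<open>n\<close> diagonal ones and the fraction
      \<open>1 - \<alpha> < \<gamma> / 4\<close> of pairs that are not \<open>P\<close>-intersecting together.\<close>
    case False
    define n where "n = real (card I)"
    have "\<forall>i\<in>I. \<exists>a b. B i = cbox a b" using boxes by (auto simp: boxes_def)
    then obtain a b where ab: "\<And>i. i \<in> I \<Longrightarrow> B i = cbox (a i) (b i)" by metis
    define col where "col x y = ({k. a x $ k \<le> a y $ k}, {k. b x $ k \<le> b y $ k})" for x y
    define F where "F p = {y \<in> I. col (fst p) y = col y (snd p)}" for p
    define G where "G = {p \<in> I \<times> I. \<gamma> / 2 * n \<le> real (card (F p))}"
    have "\<gamma> * real (card I) ^ 3 \<le> real (card (SIGMA p:I \<times> I. F p))"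
      using many_equicoloured_triples[OF \<open>finite I\<close>, of col] by (simp add: \<gamma>_def F_def)
    then have G: "\<gamma> / 2 * n ^ 2 \<le> real (card G)"
      using many_heavy_pairs[OF \<open>finite I\<close>, of F \<gamma>] \<gamma> by (auto simp: F_def G_def n_def)
    have "n > 0" using I by (simp add: n_def)
    then have "n < \<gamma> / 4 * n ^ 2" using False by (simp add: n_def power2_eq_square)
    moreover have "(1 - \<alpha>) * n ^ 2 \<le> \<gamma> / 4 * n ^ 2" using \<alpha> by (intro mult_right_mono) auto
    ultimately have "(1 - \<alpha>) * n ^ 2 + n < real (card G)" using G by linarith
    then have "\<exists>(x, z)\<in>G. {x, z} \<in> P_intersecting_pairs P B I"
      using \<open>\<alpha> \<le> 1\<close> dense \<open>finite I\<close>
      by (intro dense_pairs_meet_dense_relation[of I]) (auto simp: G_def n_def P_intersecting_pairs_def)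
    then obtain x z where xz: "(x, z) \<in> G" "P_intersecting P B {x, z}"
      by (auto simp: P_intersecting_pairs_def)
    then have xzI: "x \<in> I" "z \<in> I" by (auto simp: G_def)
    have sub: "B x \<inter> B z \<subseteq> B y" if "y \<in> F (x, z)" for y
      using that xzI same_endpoint_order_imp_Int_subset[of a x y z b]
      by (auto simp: F_def col_def ab)
    have big: "\<gamma> / 2 * n \<le> real (card (F (x, z)))" using xz by (simp add: G_def)
    moreover have "0 < \<gamma> / 2 * n" using \<open>n > 0\<close> \<gamma> by simp
    ultimately have "F (x, z) \<noteq> {}" by auto
    then have "P_intersecting P B (F (x, z))"
      using P xz(2) sub I boxes
      by (intro P_intersecting_of_superboxes[where A = "B x \<inter> B z"]) (auto simp: F_def P_intersecting_def)
    with big show ?thesis by (intro exI[of _ "F (x, z)"]) (auto simp: F_def n_def)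
  qed
  show ?thesis
    using \<gamma> main by (intro exI[of _ "\<gamma> / 4"] exI[of _ "\<gamma> / 2"] conjI allI impI) auto
qed

end
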